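(* Let $U$ be a non-empty finite set and let $R \subseteq U\times U$ be a binary relation on $U$. Then the family $\mathcal{S}_p=\{R_p(x)\mid x\in U\}$ forms a subbase for some topology on $U$ if and only if $R$ is serial.
   Context: For $x\in U$, the predecessor neighborhood of $x$ is $R_p(x)=\{y\in U\mid (y,x)\in R\}$. $R$ is serial if for each $x\in U$ there exists $y\in U$ such that $(x,y)\in R$. A family $\mathcal{S}\subseteq T$ is a subbase for a topology $T$ on $U$ if the family of all intersections of finitely many (at least one; the empty intersection is not used) members of $\mathcal{S}$ is a base for $T$, i.e. every open set is a union of members of that family. Under this convention, $\mathcal{S}\subseteq P(U)$ is a subbase for some topology on $U$ if and only if $U=\bigcup\{S\mid S\in\mathcal{S}\}$. *)

theory Defs
  imports "HOL-Analysis.Abstract_Topology"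
begin

definition pred_nbhd :: "'a set \<Rightarrow> ('a \<times> 'a) set \<Rightarrow> 'a \<Rightarrow> 'a set" where
  "pred_nbhd U R x = {y \<in> U. (y, x) \<in> R}"

definition serial_on :: "'a set \<Rightarrow> ('a \<times> 'a) set \<Rightarrow> bool" where
  "serial_on U R \<longleftrightarrow> (\<forall>x\<in>U. \<exists>y\<in>U. (x, y) \<in> R)"

definition base_of :: "'a set set \<Rightarrow> 'a topology \<Rightarrow> bool" where
  "base_of \<B> T \<longleftrightarrow>
     (\<forall>B\<in>\<B>. openin T B) \<and> (\<forall>W. openin T W \<longrightarrow> (\<exists>\<U>\<subseteq>\<B>. \<Union>\<U> = W))"

(* Only intersections of non-empty finite subfamilies are taken, so a subbase has to cover
   the space. The library's openin_subbase differs: it takes "finite intersection_of" relative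
   to the space, so that the empty intersection contributes the whole space. *)
definition subbase_of :: "'a set set \<Rightarrow> 'a topology \<Rightarrow> bool" where
  "subbase_of \<S> T \<longleftrightarrow>
     (\<forall>S\<in>\<S>. openin T S) \<and> base_of {W. (finite' intersection_of (\<lambda>S. S \<in> \<S>)) W} T"

end

theory Submission
  imports Defs
begin

text \<open>Being a subbase for some topology on \<open>U\<close> amounts to covering
  \<open>U\<close>, which is \<open>ex_topology_subbase_of_iff\<close>. If \<open>\<S>\<close> is a
  subbase, the open set \<open>U\<close> is a union of finite intersections, each lying inside a
  member of \<open>\<S>\<close> because the empty intersection is excluded. Conversely, the unions
  of non-empty finite intersections of members of a cover form a topology on \<open>U\<close>.
  Predecessor neighborhoods cover \<open>U\<close> exactly when every point is a predecessor of some
  point of \<open>U\<close>, which is seriality.\<close>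

lemma ex_topology_subbase_of_iff:
  "(\<exists>T. topspace T = U \<and> subbase_of \<S> T) \<longleftrightarrow> \<Union>\<S> = U"
proof
  assume "\<exists>T. topspace T = U \<and> subbase_of \<S> T"
  then obtain T where T: "topspace T = U" and sub: "subbase_of \<S> T"
    by blast
  have "\<Union>\<S> \<subseteq> U"
    using sub T openin_subset unfolding subbase_of_def by blast
  moreover have "U \<subseteq> \<Union>\<S>"
  proof -
    obtain \<U> where \<U>: "\<U> \<subseteq> {W. (finite' intersection_of (\<lambda>S. S \<in> \<S>)) W}" "\<Union>\<U> = U"
      using sub T openin_topspace unfolding subbase_of_def base_of_def by metis
    have "W \<subseteq> \<Union>\<S>" if "W \<in> \<U>" for W
    proof -
      have "(finite' intersection_of (\<lambda>S. S \<in> \<S>)) W"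
        using \<U>(1) that by blast
      then obtain \<V> where "finite' \<V>" "\<V> \<subseteq> \<S>" "\<Inter>\<V> = W"
        unfolding intersection_of_def by auto
      \<comment> \<open>Since \<open>\<V>\<close> is non-empty, \<open>W\<close> lies inside any one
        of its members.\<close>
      then show ?thesis
        by blast
    qed
    then show ?thesis
      using \<U>(2) by blast
  qed
  ultimately show "\<Union>\<S> = U" ..
next
  assume U: "\<Union>\<S> = U"
  \<comment> \<open>\<open>P\<close> singles out the candidate base; the open sets of the topology
    will be the arbitrary unions of \<open>P\<close>-sets.\<close>
  define P where "P = finite' intersection_of (\<lambda>S. S \<in> \<S>)"
  have P_subset: "W \<subseteq> U" if "P W" for W
    using that U unfolding P_def intersection_of_def by blast
  have P_subbase: "P S" if "S \<in> \<S>" for S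
    unfolding P_def by (rule finite'_intersection_of_inc) (use that in simp)
  \<comment> \<open>Closure under binary intersection is what makes the unions of
    \<open>P\<close>-sets a topology, whose space is the union of all \<open>P\<close>-sets.\<close>
  have "P (A \<inter> B)" if "P A" "P B" for A B
    using that unfolding P_def by (rule finite'_intersection_of_Int)
  then have "istopology (arbitrary union_of P)"
    by (rule istopology_base)
  then obtain T where openin_iff: "openin T = arbitrary union_of P"
    using topology_inverse' by blast
  have "topspace T = U"
  proof
    show "topspace T \<subseteq> U"
      using P_subset unfolding topspace_def openin_iff unfolding union_of_def by blast
    \<comment> \<open>Covering enters here: the members of \<open>\<S>\<close> are open and exhaust
      \<open>U\<close>.\<close>
    show "U \<subseteq> topspace T"
      using U P_subbase arbitrary_union_of_inc unfolding topspace_def openin_iff by blast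
  qed
  moreover have "subbase_of \<S> T"
    unfolding subbase_of_def base_of_def P_def[symmetric]
  proof (intro conjI ballI allI impI)
    show "openin T W" if "W \<in> Collect P" for W
      using that arbitrary_union_of_inc unfolding openin_iff by blast
    show "openin T S" if "S \<in> \<S>" for S
      using P_subbase[OF that] arbitrary_union_of_inc unfolding openin_iff by blast
    show "\<exists>\<U>\<subseteq>Collect P. \<Union>\<U> = W" if "openin T W" for W
      using that unfolding openin_iff union_of_def by blast
  qed
  ultimately show "\<exists>T. topspace T = U \<and> subbase_of \<S> T"
    by blast
qed

theorem theorem7:
  fixes U :: "'a set" and R :: "('a \<times> 'a) set"
  assumes "finite U" and "U \<noteq> {}" and "R \<subseteq> U \<times> U"
  shows "(\<exists>T. topspace T = U \<and> subbase_of {pred_nbhd U R x | x. x \<in> U} T) \<longleftrightarrow> serial_on U R"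
  \<comment> \<open>A point \<open>y\<close> of \<open>U\<close> lies in the neighborhood of
    \<open>x\<close> iff \<open>(y, x) \<in> R\<close>, so covering \<open>y\<close> means giving it
    a successor in \<open>U\<close>.\<close>
  unfolding ex_topology_subbase_of_iff pred_nbhd_def serial_on_def by blast

end
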